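(* Let $L$ be a loop condition of width $m\geq 2$, arity $n\geq 1$, and (finite) variable set $V$, let $R_L\subseteq V^m$ be the relation associated with $L$, and let $\mathbf{A}$ be an algebra with domain $A$. The following are equivalent: (a) $\mathbf{A}$ satisfies $L$; (b) for every $R \subseteq (A^{A^V})^m$ preserved by $\mathbf{A}^{A^V}$, if there is a homomorphism from $R_L$ to $R$, then $R$ has a loop; (c) for every $R \subseteq (A^{A^V})^m$ preserved by $\mathbf{A}^{A^V}$, if there is an injective homomorphism from $R_L$ to $R$, then $R$ has a loop.
   Context: A loop condition of arity $n\ge 1$ and width $m\ge 2$ with finite variable set $V$ is a set $L$ of identities of the form $f(x_{1,1},\ldots,x_{1,n})\approx f(x_{2,1},\ldots,x_{2,n})\approx\cdots\approx f(x_{m,1},\ldots,x_{m,n})$, where $f$ is an $n$-ary function symbol and each $x_{i,j}\in V$. The relation associated with $L$ is $R_L:=\{(x_{1,i},\ldots,x_{m,i}) \mid 1\le i\le n\}\subseteq V^m$. An algebra $\mathbf{A}$ satisfies $L$ if there is an $n$-ary term operation $f$ of $\mathbf{A}$ such that all the equations hold for all assignments of values in $A$ to the variables in $V$. (Term operations include all projections; the symbol $f$ is unrelated to the signature of $\mathbf{A}$.) For a set $I$, $\mathbf{A}^I$ is the power of $\mathbf{A}$, with domain $A^I$ and operations acting componentwise. Here $A^V$ is the set of all functions $V\to A$ and $A^{A^V}$ is the set of all functions $A^V\to A$. A relation $R\subseteq B^m$ is preserved by an algebra with domain $B$ if for every ($k$-ary) operation $g$ of the algebra and all $r_1,\dots,r_k\in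 R$ the tuple $g(r_1,\dots,r_k)$, computed componentwise, lies in $R$. For relations $R\subseteq B^m$, $Q\subseteq D^m$, a homomorphism from $R$ to $Q$ is a map $h\colon B\to D$ with $(h(b_1),\dots,h(b_m))\in Q$ whenever $(b_1,\dots,b_m)\in R$ (for $R_L$ the underlying set is $V$). A loop in a relation is a constant tuple belonging to it. *)

theory Defs
  imports "HOL-Library.FuncSet"
begin

text \<open>
  Algebras have a carrier set, which may be empty, and finitary operations indexed by a set of
  symbols. Tuples are lists; the values of an operation on lists of the wrong length or with
  entries outside the carrier are irrelevant.
\<close>

record ('f, 'a) algebra =
  carrier :: "'a set"
  symbols :: "'f set"
  arity :: "'f \<Rightarrow> nat"
  oper :: "'f \<Rightarrow> 'a list \<Rightarrow> 'a"

definition tuples :: "'a set \<Rightarrow> nat \<Rightarrow> 'a list set" where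
  "tuples B k = {xs. length xs = k \<and> set xs \<subseteq> B}"

definition is_algebra :: "('f, 'a) algebra \<Rightarrow> bool" where
  "is_algebra A \<longleftrightarrow>
    (\<forall>f \<in> symbols A. \<forall>xs \<in> tuples (carrier A) (arity A f). oper A f xs \<in> carrier A)"

definition power_algebra :: "('f, 'a) algebra \<Rightarrow> 'i set \<Rightarrow> ('f, 'i \<Rightarrow> 'a) algebra" where
  "power_algebra A I =
    \<lparr> carrier = I \<rightarrow>\<^sub>E carrier A,
      symbols = symbols A,
      arity = arity A,
      oper = (\<lambda>f us. \<lambda>i\<in>I. oper A f (map (\<lambda>u. u i) us)) \<rparr>"

lemma is_algebra_power_algebra:
  assumes "is_algebra A"
  shows "is_algebra (power_algebra A I)"
  unfolding is_algebra_def
proof (intro ballI)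
  fix f us
  assume f: "f \<in> symbols (power_algebra A I)"
    and us: "us \<in> tuples (carrier (power_algebra A I)) (arity (power_algebra A I) f)"
  have "map (\<lambda>u. u i) us \<in> tuples (carrier A) (arity A f)" if "i \<in> I" for i
    using us that by (auto simp: power_algebra_def tuples_def)
  then show "oper (power_algebra A I) f us \<in> carrier (power_algebra A I)"
    using f assms by (auto simp: power_algebra_def is_algebra_def)
qed

datatype 'f trm = Var nat | App 'f "'f trm list"

text \<open>The terms over the signature of \<open>A\<close> in the variables \<open>Var 0, \<dots>, Var (n - 1)\<close>.\<close>

inductive_set terms :: "('f, 'a) algebra \<Rightarrow> nat \<Rightarrow> 'f trm set"
  for A :: "('f, 'a) algebra" and n :: nat where
  Var: "i < n \<Longrightarrow> Var i \<in> terms A n"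
| App: "\<lbrakk>f \<in> symbols A; length ts = arity A f; \<forall>t \<in> set ts. t \<in> terms A n\<rbrakk>
    \<Longrightarrow> App f ts \<in> terms A n"

primrec eval_term :: "('f, 'a) algebra \<Rightarrow> 'a list \<Rightarrow> 'f trm \<Rightarrow> 'a" where
  "eval_term A xs (Var i) = xs ! i"
| "eval_term A xs (App f ts) = oper A f (map (eval_term A xs) ts)"

definition term_operation :: "('f, 'a) algebra \<Rightarrow> nat \<Rightarrow> ('a list \<Rightarrow> 'a) \<Rightarrow> bool" where
  "term_operation A n g \<longleftrightarrow>
    (\<exists>t \<in> terms A n. \<forall>xs \<in> tuples (carrier A) n. g xs = eval_term A xs t)"

text \<open>
  A loop condition is given by the list of its \<open>m\<close> argument rows: the chain
  \<open>f(x\<^sub>1\<^sub>,\<^sub>1, \<dots>, x\<^sub>1\<^sub>,\<^sub>n) \<approx> \<dots> \<approx> f(x\<^sub>m\<^sub>,\<^sub>1, \<dots>, x\<^sub>m\<^sub>,\<^sub>n)\<close> is represented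
  by \<open>L\<close> with \<open>x\<^sub>i\<^sub>,\<^sub>j = L ! (i - 1) ! (j - 1)\<close>.
  Not every element of \<open>V\<close> has to occur in \<open>L\<close>.
\<close>

definition loop_condition :: "nat \<Rightarrow> nat \<Rightarrow> 'v set \<Rightarrow> 'v list list \<Rightarrow> bool" where
  "loop_condition n m V L \<longleftrightarrow> n \<ge> 1 \<and> m \<ge> 2 \<and> finite V \<and> L \<in> tuples (tuples V n) m"

text \<open>The pair \<open>(xs, ys)\<close> stands for the identity \<open>f(xs) \<approx> f(ys)\<close>.\<close>

definition identities :: "'v list list \<Rightarrow> ('v list \<times> 'v list) set" where
  "identities L = {(L ! i, L ! Suc i) | i. Suc i < length L}"

definition satisfies :: "('f, 'a) algebra \<Rightarrow> nat \<Rightarrow> 'v set \<Rightarrow> 'v list list \<Rightarrow> bool" where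
  "satisfies A n V L \<longleftrightarrow>
    (\<exists>f. term_operation A n f \<and>
      (\<forall>s \<in> V \<rightarrow>\<^sub>E carrier A. \<forall>(xs, ys) \<in> identities L. f (map s xs) = f (map s ys)))"

definition loop_relation :: "nat \<Rightarrow> 'v list list \<Rightarrow> 'v list set" where
  "loop_relation n L = {map (\<lambda>xs. xs ! j) L | j. j < n}"

definition preserved :: "('f, 'b) algebra \<Rightarrow> nat \<Rightarrow> 'b list set \<Rightarrow> bool" where
  "preserved B m R \<longleftrightarrow>
    (\<forall>g \<in> symbols B. \<forall>rs \<in> tuples R (arity B g).
      map (\<lambda>i. oper B g (map (\<lambda>r. r ! i) rs)) [0..<m] \<in> R)"

text \<open>Homomorphisms from \<open>R \<subseteq> B\<^sup>m\<close> to \<open>Q \<subseteq> D\<^sup>m\<close>; only the values of \<open>h\<close> on \<open>B\<close> matter.\<close>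

definition rel_hom :: "'b set \<Rightarrow> 'b list set \<Rightarrow> 'd set \<Rightarrow> 'd list set \<Rightarrow> ('b \<Rightarrow> 'd) \<Rightarrow> bool" where
  "rel_hom B R D Q h \<longleftrightarrow> h \<in> B \<rightarrow> D \<and> (\<forall>r \<in> R. map h r \<in> Q)"

definition has_loop :: "nat \<Rightarrow> 'b list set \<Rightarrow> bool" where
  "has_loop m R \<longleftrightarrow> (\<exists>b. replicate m b \<in> R)"

end

theory Submission
  imports Defs
begin

text \<open>
  If a term operation witnesses \<open>L\<close>, applying it to the images of the columns of \<open>L\<close> under a
  homomorphism yields a loop, coordinate by coordinate. Conversely, let \<open>h v\<close> be the projection
  \<open>s \<mapsto> s v\<close>. A loop in the subpower generated by the \<open>h\<close>-images of the columns of \<open>L\<close> is a term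
  that takes equal values on all rows of \<open>L\<close> under all assignments. The map \<open>h\<close> is injective
  unless the carrier has at most one element, and in that case every loop condition holds.
\<close>

section \<open>Terms in powers and invariant relations\<close>

lemma power_algebra_simps [simp]:
  "carrier (power_algebra A I) = I \<rightarrow>\<^sub>E carrier A"
  "symbols (power_algebra A I) = symbols A"
  "arity (power_algebra A I) = arity A"
  "oper (power_algebra A I) f us = (\<lambda>i\<in>I. oper A f (map (\<lambda>u. u i) us))"
  by (simp_all add: power_algebra_def)

lemma terms_power_algebra [simp]: "terms (power_algebra A I) n = terms A n"
proof (intro set_eqI iffI)
  fix t assume "t \<in> terms (power_algebra A I) n"
  then show "t \<in> terms A n"
    by induction (auto intro: terms.intros)
next
  fix t assume "t \<in> terms A n"
  then show "t \<in> terms (power_algebra A I) n"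
    by induction (auto intro: terms.intros)
qed

lemma eval_term_in_carrier:
  assumes "is_algebra A" and "xs \<in> tuples (carrier A) n" and "t \<in> terms A n"
  shows "eval_term A xs t \<in> carrier A"
  using assms(3)
proof induction
  case (Var i)
  then show ?case using assms(2) by (auto simp: tuples_def)
next
  case (App f ts)
  then have "map (eval_term A xs) ts \<in> tuples (carrier A) (arity A f)"
    by (auto simp: tuples_def)
  with App assms(1) show ?case by (auto simp: is_algebra_def)
qed

text \<open>Each coordinate projection is a homomorphism from the power to \<open>A\<close>, so it
  commutes with terms. The index has to lie in \<open>I\<close> because elsewhere the operations of
  the power return \<open>undefined\<close>.\<close>

lemma eval_term_power_algebra:
  assumes "t \<in> terms A n" and "length us = n" and "i \<in> I"
  shows "eval_term (power_algebra A I) us t i = eval_term A (map (\<lambda>u. u i) us) t"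
  using assms(1)
proof induction
  case (Var k)
  then show ?case using assms(2) by simp
next
  case (App f ts)
  then have "map (\<lambda>t. eval_term (power_algebra A I) us t i) ts =
      map (eval_term A (map (\<lambda>u. u i) us)) ts"
    by simp
  then show ?case using assms(3) by (simp add: comp_def cong: map_cong)
qed

text \<open>Invariance passes from basic operations to term operations by induction on the term. The
  tuples must have length exactly \<open>m\<close>, so that in the variable case rebuilding a tuple
  from its entries returns the tuple itself.\<close>

lemma preserved_eval_term:
  assumes "preserved B m R" and "\<forall>r \<in> R. length r = m"
    and "rs \<in> tuples R n" and "t \<in> terms B n"
  shows "map (\<lambda>i. eval_term B (map (\<lambda>r. r ! i) rs) t) [0..<m] \<in> R"
  using assms(4)
proof induction
  case (Var k)
  then have "rs ! k \<in> R" "k < length rs" using assms(3) by (auto simp: tuples_def)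
  then have "map (\<lambda>i. eval_term B (map (\<lambda>r. r ! i) rs) (Var k)) [0..<m] = rs ! k"
    using assms(2) by (auto intro: nth_equalityI)
  then show ?case using \<open>rs ! k \<in> R\<close> by simp
next
  case (App f ts)
  \<comment> \<open>View \<open>rs\<close> as the columns of a matrix: \<open>?col t\<close> lists
    the values of \<open>t\<close> on its \<open>m\<close> rows. By induction the tuples
    \<open>?col t\<close> for the arguments \<open>t\<close> of \<open>f\<close> are in
    \<open>R\<close>.\<close>
  let ?col = "\<lambda>t. map (\<lambda>i. eval_term B (map (\<lambda>r. r ! i) rs) t) [0..<m]"
  have "map ?col ts \<in> tuples R (arity B f)"
    using App by (auto simp: tuples_def)
  then have "map (\<lambda>i. oper B f (map (\<lambda>r. r ! i) (map ?col ts))) [0..<m] \<in> R"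
    using assms(1) App.hyps(1) unfolding preserved_def by blast
  also have "map (\<lambda>i. oper B f (map (\<lambda>r. r ! i) (map ?col ts))) [0..<m] = ?col (App f ts)"
    by (auto simp: comp_def)
  finally show ?case .
qed

text \<open>For rows \<open>M\<close> of length \<open>n\<close> this is the relation generated by
  the columns of the matrix. It is closed because applying \<open>g\<close> to tuples given by terms
  amounts to evaluating the composite term.\<close>

lemma preserved_generated:
  "preserved B (length M) {map (\<lambda>us. eval_term B us t) M | t. t \<in> terms B n}"
    (is "preserved B _ ?R")
  unfolding preserved_def
proof (intro ballI)
  fix g rs assume g: "g \<in> symbols B" and rs: "rs \<in> tuples ?R (arity B g)"
  \<comment> \<open>Choose one term \<open>tm r\<close> producing each argument tuple
    \<open>r\<close>; these become the arguments of the composite term.\<close>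
  have "\<forall>r \<in> set rs. \<exists>t. t \<in> terms B n \<and> r = map (\<lambda>us. eval_term B us t) M"
    using rs by (auto simp: tuples_def)
  then obtain tm where tm: "\<And>r. r \<in> set rs \<Longrightarrow> tm r \<in> terms B n"
      "\<And>r. r \<in> set rs \<Longrightarrow> r = map (\<lambda>us. eval_term B us (tm r)) M"
    by metis
  have nth: "r ! i = eval_term B (M ! i) (tm r)" if "r \<in> set rs" "i < length M" for r i
    using tm(2)[OF that(1)] that(2) by (metis nth_map)
  have "App g (map tm rs) \<in> terms B n"
    using g rs tm(1) by (auto simp: tuples_def intro!: terms.App)
  moreover have "map (\<lambda>i. oper B g (map (\<lambda>r. r ! i) rs)) [0..<length M] =
      map (\<lambda>us. eval_term B us (App g (map tm rs))) M"
  proof (rule nth_equalityI)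
    fix i assume "i < length (map (\<lambda>i. oper B g (map (\<lambda>r. r ! i) rs)) [0..<length M])"
    then have i: "i < length M" by simp
    then have "map (\<lambda>r. r ! i) rs = map (\<lambda>r. eval_term B (M ! i) (tm r)) rs"
      using nth by simp
    with i show "map (\<lambda>i. oper B g (map (\<lambda>r. r ! i) rs)) [0..<length M] ! i =
        map (\<lambda>us. eval_term B us (App g (map tm rs))) M ! i"
      by (simp add: comp_def cong: map_cong)
  qed simp
  ultimately show "map (\<lambda>i. oper B g (map (\<lambda>r. r ! i) rs)) [0..<length M] \<in> ?R"
    by blast
qed

section \<open>Loop conditions as conditions on a single term\<close>

lemma loop_condition_row:
  assumes "loop_condition n m V L" and "i < m"
  shows "L ! i \<in> tuples V n"
proof -
  have "L ! i \<in> set L" and "set L \<subseteq> tuples V n"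
    using assms by (simp_all add: loop_condition_def tuples_def)
  then show ?thesis by blast
qed

text \<open>Chaining consecutive identities compares every row with row 0; conversely, neighbouring
  rows agree because both agree with row 0. The operation can be replaced by a term since every
  assignment sends the rows into the carrier.\<close>

lemma satisfies_iff:
  assumes "loop_condition n m V L"
  shows "satisfies A n V L \<longleftrightarrow>
    (\<exists>t \<in> terms A n. \<forall>s \<in> V \<rightarrow>\<^sub>E carrier A. \<forall>i < m.
      eval_term A (map s (L ! i)) t = eval_term A (map s (L ! 0)) t)"
    (is "_ \<longleftrightarrow> (\<exists>t \<in> terms A n. ?P t)")
proof -
  have L: "length L = m" using assms by (simp add: loop_condition_def tuples_def)
  have row: "map s (L ! i) \<in> tuples (carrier A) n" if "s \<in> V \<rightarrow>\<^sub>E carrier A" "i < m" for s i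
    using loop_condition_row[OF assms that(2)] that(1) by (auto simp: tuples_def)
  show ?thesis
  proof
    assume "satisfies A n V L"
    then obtain f t where t: "t \<in> terms A n"
      and f: "\<forall>xs \<in> tuples (carrier A) n. f xs = eval_term A xs t"
      and eq: "\<forall>s \<in> V \<rightarrow>\<^sub>E carrier A. \<forall>(xs, ys) \<in> identities L. f (map s xs) = f (map s ys)"
      by (auto simp: satisfies_def term_operation_def)
    have "f (map s (L ! i)) = f (map s (L ! 0))" if "s \<in> V \<rightarrow>\<^sub>E carrier A" "i < m" for s i
      using that(2)
    proof (induction i)
      case (Suc i)
      then have "(L ! i, L ! Suc i) \<in> identities L" using L by (auto simp: identities_def)
      with eq that(1) have "f (map s (L ! i)) = f (map s (L ! Suc i))" by blast
      with Suc show ?case by simp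
    qed simp
    then have "?P t" using row f
      by (metis (no_types, lifting) bot_nat_0.not_eq_extremum not_less_zero)
    with t show "\<exists>t \<in> terms A n. ?P t" by blast
  next
    assume "\<exists>t \<in> terms A n. ?P t"
    then obtain t where t: "t \<in> terms A n" "?P t" by blast
    have "\<forall>s \<in> V \<rightarrow>\<^sub>E carrier A. \<forall>(xs, ys) \<in> identities L.
        eval_term A (map s xs) t = eval_term A (map s ys) t"
      using t(2) L by (auto simp: identities_def)
    with t(1) show "satisfies A n V L"
      unfolding satisfies_def term_operation_def
      by (intro exI[of _ "\<lambda>xs. eval_term A xs t"]) blast
  qed
qed

section \<open>From a term for the loop condition to loops\<close>

lemma satisfies_imp_has_loop:
  assumes "is_algebra A" and L: "loop_condition n m V L" and "satisfies A n V L"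
    and R: "R \<subseteq> tuples (carrier (power_algebra A I)) m" "preserved (power_algebra A I) m R"
    and h: "rel_hom V (loop_relation n L) (carrier (power_algebra A I)) R h"
  shows "has_loop m R"
proof -
  let ?B = "power_algebra A I"
  have m: "m > 0" "length L = m"
    using L by (auto simp: loop_condition_def tuples_def)
  note row = loop_condition_row[OF L]
  obtain t where t: "t \<in> terms A n"
    and eq: "\<And>s i. s \<in> V \<rightarrow>\<^sub>E carrier A \<Longrightarrow> i < m \<Longrightarrow>
      eval_term A (map s (L ! i)) t = eval_term A (map s (L ! 0)) t"
    using assms(3) satisfies_iff[OF L] by blast
  have hV: "h v \<in> I \<rightarrow>\<^sub>E carrier A" if "v \<in> V" for v
    using h that by (auto simp: rel_hom_def)
  \<comment> \<open>These are the \<open>h\<close>-images of the columns of \<open>L\<close>, which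
    lie in \<open>R\<close>; the matrix they form has the rows \<open>map h (L ! i)\<close>.\<close>
  define rs where "rs = map (\<lambda>j. map (\<lambda>xs. h (xs ! j)) L) [0..<n]"
  have "map (\<lambda>xs. h (xs ! j)) L \<in> R" if "j < n" for j
  proof -
    have "map h (map (\<lambda>xs. xs ! j) L) \<in> R"
      using h that unfolding rel_hom_def loop_relation_def by blast
    then show ?thesis by (simp add: comp_def)
  qed
  then have "rs \<in> tuples R n" by (auto simp: rs_def tuples_def)
  then have "map (\<lambda>i. eval_term ?B (map (\<lambda>r. r ! i) rs) t) [0..<m] \<in> R"
    using R t by (intro preserved_eval_term[where n = n]) (auto simp: tuples_def)
  moreover have "eval_term ?B (map (\<lambda>r. r ! i) rs) t = eval_term ?B (map h (L ! 0)) t"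
    if i: "i < m" for i
  proof -
    have "map (\<lambda>r. r ! i) rs = map h (L ! i)"
      using i m row[OF i] by (auto simp: rs_def tuples_def intro!: nth_equalityI)
    moreover have "eval_term ?B (map h (L ! i)) t = eval_term ?B (map h (L ! 0)) t"
    proof (rule PiE_ext)
      have mem: "eval_term ?B (map h (L ! k)) t \<in> I \<rightarrow>\<^sub>E carrier A" if "k < m" for k
      proof -
        have "map h (L ! k) \<in> tuples (carrier ?B) n"
          using row[OF that] hV by (auto simp: tuples_def)
        then have "eval_term ?B (map h (L ! k)) t \<in> carrier ?B"
          using t by (intro eval_term_in_carrier[OF is_algebra_power_algebra[OF assms(1)]]) auto
        then show ?thesis by simp
      qed
      show "eval_term ?B (map h (L ! i)) t \<in> I \<rightarrow>\<^sub>E carrier A"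
        and "eval_term ?B (map h (L ! 0)) t \<in> I \<rightarrow>\<^sub>E carrier A"
        using mem i m(1) by blast+
      fix p assume p: "p \<in> I"
      \<comment> \<open>Evaluating the images \<open>h v\<close> at the coordinate \<open>p\<close>
        gives an assignment in \<open>A\<close>, so equality at \<open>p\<close> is an instance of
        the identities of \<open>L\<close>.\<close>
      define s where "s = (\<lambda>v\<in>V. h v p)"
      have s: "s \<in> V \<rightarrow>\<^sub>E carrier A" using hV p by (auto simp: s_def)
      have "eval_term ?B (map h (L ! k)) t p = eval_term A (map s (L ! k)) t" if "k < m" for k
      proof -
        have "map (\<lambda>u. u p) (map h (L ! k)) = map s (L ! k)"
          using row[OF that] by (auto simp: s_def tuples_def)
        moreover have "length (map h (L ! k)) = n"
          using row[OF that] by (simp add: tuples_def)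
        ultimately show ?thesis using eval_term_power_algebra[OF t _ p] by metis
      qed
      then show "eval_term ?B (map h (L ! i)) t p = eval_term ?B (map h (L ! 0)) t p"
        using eq[OF s i] i m(1) by simp
    qed
    ultimately show ?thesis by simp
  qed
  then have "map (\<lambda>i. eval_term ?B (map (\<lambda>r. r ! i) rs) t) [0..<m] =
      replicate m (eval_term ?B (map h (L ! 0)) t)"
    by (auto intro: nth_equalityI)
  ultimately show ?thesis unfolding has_loop_def by metis
qed

section \<open>From loops to a term for the loop condition\<close>

lemma satisfies_if_subsingleton:
  assumes "is_algebra A" and L: "loop_condition n m V L"
    and "\<And>a b. a \<in> carrier A \<Longrightarrow> b \<in> carrier A \<Longrightarrow> a = b"
  shows "satisfies A n V L"
proof -
  have "n > 0" "m > 0" using L by (auto simp: loop_condition_def)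
  \<comment> \<open>A projection suffices, as any two values in the carrier coincide; it exists
    because \<open>n \<ge> 1\<close>.\<close>
  have t: "Var 0 \<in> terms A n" using \<open>n > 0\<close> by (rule terms.Var)
  have "eval_term A (map s (L ! i)) (Var 0) \<in> carrier A"
    if "s \<in> V \<rightarrow>\<^sub>E carrier A" "i < m" for s i
    using loop_condition_row[OF L that(2)] that(1) by (intro eval_term_in_carrier[OF assms(1) _ t])
      (auto simp: tuples_def)
  with t \<open>m > 0\<close> assms(3) show ?thesis unfolding satisfies_iff[OF L] by meson
qed

text \<open>One well-chosen pair of \<open>R\<close> and \<open>h\<close> yields the term. Asking
  for loops only when \<open>h\<close> is injective makes the lemma prove the implication from (c)
  to (a).\<close>

lemma satisfies_if_has_loop:
  fixes A :: "('f, 'a) algebra" and V :: "'v set"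
  defines "B \<equiv> power_algebra A (V \<rightarrow>\<^sub>E carrier A)"
  assumes "is_algebra A" and L: "loop_condition n m V L"
    and loops: "\<And>R h. R \<subseteq> tuples (carrier B) m \<Longrightarrow> preserved B m R \<Longrightarrow>
      rel_hom V (loop_relation n L) (carrier B) R h \<Longrightarrow> inj_on h V \<Longrightarrow> has_loop m R"
  shows "satisfies A n V L"
proof (cases "\<exists>a \<in> carrier A. \<exists>b \<in> carrier A. a \<noteq> b")
  case False
  then show ?thesis using satisfies_if_subsingleton[OF assms(2) L] by blast
next
  case True
  then obtain a b where ab: "a \<in> carrier A" "b \<in> carrier A" "a \<noteq> b" by blast
  let ?I = "V \<rightarrow>\<^sub>E carrier A"
  have m: "m > 0" "length L = m" and row: "\<And>xs. xs \<in> set L \<Longrightarrow> xs \<in> tuples V n"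
    using L by (auto simp: loop_condition_def tuples_def)
  define h :: "'v \<Rightarrow> ('v \<Rightarrow> 'a) \<Rightarrow> 'a" where "h = (\<lambda>v. \<lambda>s\<in>?I. s v)"
  define R where "R = {map (\<lambda>us. eval_term B us t) (map (map h) L) | t. t \<in> terms B n}"
  have hV: "h v \<in> carrier B" if "v \<in> V" for v
    using that by (auto simp: h_def B_def)
  have "R \<subseteq> tuples (carrier B) m"
  proof
    fix r assume "r \<in> R"
    then obtain t where t: "t \<in> terms B n" "r = map (\<lambda>us. eval_term B us t) (map (map h) L)"
      by (auto simp: R_def)
    have "eval_term B (map h xs) t \<in> carrier B" if "xs \<in> set L" for xs
    proof (rule eval_term_in_carrier[OF _ _ t(1)])
      show "is_algebra B" unfolding B_def by (rule is_algebra_power_algebra[OF assms(2)])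
      show "map h xs \<in> tuples (carrier B) n"
        using row[OF that] hV by (auto simp: tuples_def)
    qed
    with t(2) m show "r \<in> tuples (carrier B) m" by (auto simp: tuples_def)
  qed
  moreover have "preserved B m R"
    using preserved_generated[of B "map (map h) L" n] m by (simp add: R_def)
  moreover have "rel_hom V (loop_relation n L) (carrier B) R h"
    unfolding rel_hom_def
  proof (intro conjI ballI)
    show "h \<in> V \<rightarrow> carrier B" using hV by blast
    fix r assume "r \<in> loop_relation n L"
    then obtain j where j: "j < n" "r = map (\<lambda>xs. xs ! j) L" by (auto simp: loop_relation_def)
    \<comment> \<open>The generators themselves belong to \<open>R\<close>: the variable
      \<open>Var j\<close> picks out the \<open>j\<close>-th column.\<close>
    then have "map h r = map (\<lambda>us. eval_term B us (Var j)) (map (map h) L)"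
      using row by (auto simp: tuples_def)
    with j(1) show "map h r \<in> R" unfolding R_def by (blast intro: terms.Var)
  qed
  moreover have "inj_on h V"
  proof (rule inj_onI, rule ccontr)
    fix v w assume vw: "v \<in> V" "w \<in> V" "h v = h w" "v \<noteq> w"
    \<comment> \<open>This assignment takes different values at \<open>v\<close> and
      \<open>w\<close>, hence separates the projections \<open>h v\<close> and
      \<open>h w\<close>.\<close>
    define s where "s = (\<lambda>x\<in>V. if x = v then a else b)"
    have "s \<in> ?I" using ab by (auto simp: s_def)
    then have "s v = s w" using vw(3) by (metis h_def restrict_apply')
    with vw ab show False by (simp add: s_def)
  qed
  ultimately have "has_loop m R" by (rule loops)
  then obtain c t where t: "t \<in> terms A n"
    and c: "replicate m c = map (\<lambda>us. eval_term B us t) (map (map h) L)"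
    by (auto simp: has_loop_def R_def B_def)
  \<comment> \<open>The loop element \<open>c\<close> is read at the coordinate \<open>s\<close>,
    where each \<open>h v\<close> takes the value \<open>s v\<close>. Thus \<open>c s\<close> is the
    common value of \<open>t\<close> on all rows of \<open>L\<close> under \<open>s\<close>.\<close>
  have "eval_term A (map s (L ! i)) t = c s" if s: "s \<in> ?I" and i: "i < m" for s i
  proof -
    have xs: "L ! i \<in> tuples V n" using i m(2) row by simp
    have "c = eval_term B (map h (L ! i)) t"
      using arg_cong[OF c, of "\<lambda>r. r ! i"] i m(2) by simp
    then have "c s = eval_term A (map (\<lambda>u. u s) (map h (L ! i))) t"
      using eval_term_power_algebra[OF t _ s, of "map h (L ! i)"] xs
      by (simp add: B_def tuples_def)
    also have "map (\<lambda>u. u s) (map h (L ! i)) = map s (L ! i)"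
      using s by (simp add: h_def)
    finally show ?thesis by simp
  qed
  with t m(1) show ?thesis unfolding satisfies_iff[OF L] by (metis (no_types, lifting))
qed

theorem proposition3p2:
  fixes A :: "('f, 'a) algebra" and V :: "'v set" and L :: "'v list list" and n m :: nat
  defines "B \<equiv> power_algebra A (V \<rightarrow>\<^sub>E carrier A)"
  assumes "is_algebra A" and "loop_condition n m V L"
  shows "(satisfies A n V L \<longleftrightarrow>
           (\<forall>R. R \<subseteq> tuples (carrier B) m \<and> preserved B m R \<and>
             (\<exists>h. rel_hom V (loop_relation n L) (carrier B) R h) \<longrightarrow> has_loop m R))
       \<and> (satisfies A n V L \<longleftrightarrow>
           (\<forall>R. R \<subseteq> tuples (carrier B) m \<and> preserved B m R \<and>
             (\<exists>h. rel_hom V (loop_relation n L) (carrier B) R h \<and> inj_on h V) \<longrightarrow> has_loop m R))"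
    (is "(?a \<longleftrightarrow> ?b) \<and> (?a \<longleftrightarrow> ?c)")
proof -
  \<comment> \<open>The equivalences follow from a cycle of implications. This first one holds for
    powers with any index set and is applied to the set of assignments.\<close>
  have "?a \<Longrightarrow> ?b"
    using satisfies_imp_has_loop[OF assms(2,3)] unfolding B_def by blast
  moreover have "?b \<Longrightarrow> ?c" by blast
  moreover have "?c \<Longrightarrow> ?a"
    using satisfies_if_has_loop[OF assms(2,3)] unfolding B_def by blast
  ultimately show ?thesis by blast
qed

end
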